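(* A graph $G$ on $n$ vertices is a uniquely $C_4^{+}$-saturated graph with girth $4$ if and only if $G$ is a strongly regular graph with parameters $(n,k,0,2)$ for some $k$.
   Context: All graphs are finite, simple and undirected. $C_4^{+}$ (the diamond) is the graph obtained from a $4$-cycle by adding one chord, i.e. $K_4$ minus an edge. For a graph $H$, a graph $G$ is uniquely $H$-saturated if $G$ contains no subgraph isomorphic to $H$, but for every pair of non-adjacent vertices $u,v$ of $G$, the graph $G+uv$ contains exactly one subgraph isomorphic to $H$. The girth is the minimum length of a cycle. A graph on $n$ vertices is strongly regular with parameters $(n,k,\lambda,\mu)$ if it is neither complete nor edgeless, every vertex has degree $k$, every pair of adjacent vertices has exactly $\lambda$ common neighbors, and every pair of non-adjacent vertices has exactly $\mu$ common neighbors. *)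

theory Defs
  imports "Graph_Theory.Graph_Theory" "HOL-Library.Extended_Nat"
begin

text \<open>
  A finite simple undirected graph is a \<^locale>\<open>pair_graph\<close>: an edge \<open>uv\<close> is represented by
  the two arcs \<open>(u, v)\<close> and \<open>(v, u)\<close>.
\<close>

definition add_edge :: "'a pair_pre_digraph \<Rightarrow> 'a \<Rightarrow> 'a \<Rightarrow> 'a pair_pre_digraph" where
  "add_edge G u v = G\<lparr>parcs := parcs G \<union> {(u, v), (v, u)}\<rparr>"

text \<open>
  Subgraphs (pairs of a vertex set and an edge set, not embeddings, and not necessarily induced)
  of \<open>G\<close> that are isomorphic to \<open>H\<close>.
\<close>

definition copies :: "'b pair_pre_digraph \<Rightarrow> 'a pair_pre_digraph \<Rightarrow> 'a pair_pre_digraph set" where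
  "copies H G = {K. pair_graph K \<and> subgraph (with_proj K) (with_proj G)
                    \<and> digraph_iso (with_proj K) (with_proj H)}"

definition uniquely_saturated :: "'b pair_pre_digraph \<Rightarrow> 'a pair_pre_digraph \<Rightarrow> bool" where
  "uniquely_saturated H G \<longleftrightarrow>
     copies H G = {} \<and>
     (\<forall>u \<in> pverts G. \<forall>v \<in> pverts G. u \<noteq> v \<and> (u, v) \<notin> parcs G \<longrightarrow>
        (\<exists>!K. K \<in> copies H (add_edge G u v)))"

definition C4 :: "nat pair_pre_digraph" where
  "C4 = mk_symmetric (with_proj
          \<lparr>pverts = {0, 1, 2, 3}, parcs = {(0, 1), (1, 2), (2, 3), (3, 0)}\<rparr>)"

definition diamond :: "nat pair_pre_digraph" where
  "diamond = add_edge C4 0 2"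

text \<open>
  In a symmetric digraph, \<^const>\<open>pre_digraph.cycle\<close> also accepts the closed walks \<open>u, v, u\<close> along
  a single edge; the bound on the length excludes exactly these. The girth of a forest is \<open>\<infinity>\<close>.
\<close>

definition girth :: "'a pair_pre_digraph \<Rightarrow> enat" where
  "girth G = (INF p \<in> {p. pre_digraph.cycle (with_proj G) p \<and> 3 \<le> length p}. enat (length p))"

definition common_neighbors :: "'a pair_pre_digraph \<Rightarrow> 'a \<Rightarrow> 'a \<Rightarrow> 'a set" where
  "common_neighbors G u v = {w \<in> pverts G. (u, w) \<in> parcs G \<and> (v, w) \<in> parcs G}"

definition strongly_regular ::
  "'a pair_pre_digraph \<Rightarrow> nat \<Rightarrow> nat \<Rightarrow> nat \<Rightarrow> nat \<Rightarrow> bool" where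
  "strongly_regular G n k l m \<longleftrightarrow>
     card (pverts G) = n \<and>
     \<not> complete_digraph n (with_proj G) \<and>
     parcs G \<noteq> {} \<and>
     (\<forall>v \<in> pverts G. out_degree (with_proj G) v = k) \<and>
     (\<forall>u \<in> pverts G. \<forall>v \<in> pverts G. (u, v) \<in> parcs G \<longrightarrow>
        card (common_neighbors G u v) = l) \<and>
     (\<forall>u \<in> pverts G. \<forall>v \<in> pverts G. u \<noteq> v \<and> (u, v) \<notin> parcs G \<longrightarrow>
        card (common_neighbors G u v) = m)"

lemma pverts_diamond: "pverts diamond = {0, 1, 2, 3}"
  by (simp add: diamond_def C4_def add_edge_def)

lemma parcs_diamond:
  "parcs diamond = {(u, v). u \<in> {0, 1, 2, 3} \<and> v \<in> {0, 1, 2, 3} \<and> u \<noteq> v} - {(1, 3), (3, 1)}"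
  by (auto simp: diamond_def C4_def add_edge_def parcs_mk_symmetric)

lemma pair_graph_diamond: "pair_graph diamond"
proof -
  have "finite (parcs diamond)"
    by (rule finite_subset[of _ "{0, 1, 2, 3} \<times> {0, 1, 2, 3}"]) (auto simp: parcs_diamond)
  then show ?thesis
    by unfold_locales
      (auto simp: parcs_diamond pverts_diamond symmetric_def intro!: symI)
qed

lemma pair_graph_add_edge:
  assumes "pair_graph G" "u \<in> pverts G" "v \<in> pverts G" "u \<noteq> v"
  shows "pair_graph (add_edge G u v)"
proof -
  interpret pair_graph G by fact
  have "sym (parcs G)"
    using sym_arcs by (simp add: symmetric_def)
  then have "sym (parcs (add_edge G u v))"
    by (auto simp: add_edge_def sym_def)
  then show ?thesis
    using assms(2-)
    by unfold_locales
      (auto simp: add_edge_def symmetric_def dest: in_arcsD1 in_arcsD2 no_loops)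
qed

end

theory Submission
  imports Defs
begin

text \<open>
  In a triangle-free graph, the diamonds created by adding an edge \<open>uv\<close> correspond to the pairs of
  common neighbours of \<open>u\<close> and \<open>v\<close>, and there is exactly one such pair iff \<open>u\<close> and \<open>v\<close> have exactly
  two common neighbours. So the graphs on either side are the triangle-free graphs with \<open>\<mu> = 2\<close> that
  are neither complete nor edgeless; a pair of non-adjacent vertices yields the 4-cycle, and
  regularity is automatic.
\<close>

section \<open>Diamonds as subgraphs\<close>

text \<open>\<open>u\<close> and \<open>v\<close> are the ends of the chord, \<open>x\<close> and
  \<open>y\<close> the two non-adjacent tips. Orderings that describe the same subgraph give equal
  records, so subgraphs are counted rather than embeddings.\<close>

definition diamond_on :: "'a \<Rightarrow> 'a \<Rightarrow> 'a \<Rightarrow> 'a \<Rightarrow> 'a pair_pre_digraph" where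
  "diamond_on u v x y =
     \<lparr>pverts = {u, v, x, y}, parcs = {(u, v), (v, u)} \<union> {u, v} \<times> {x, y} \<union> {x, y} \<times> {u, v}\<rparr>"

lemma pverts_diamond_on [simp]: "pverts (diamond_on u v x y) = {u, v, x, y}"
  and parcs_diamond_on [simp]: "parcs (diamond_on u v x y) =
    {(u, v), (v, u)} \<union> {u, v} \<times> {x, y} \<union> {x, y} \<times> {u, v}"
  by (simp_all add: diamond_on_def)

lemma diamond_on_swap_chord: "diamond_on v u x y = diamond_on u v x y"
  by (auto simp: diamond_on_def)

lemma diamond_on_swap_tips: "diamond_on u v y x = diamond_on u v x y"
  by (auto simp: diamond_on_def)

lemma diamond_eq_diamond_on: "diamond = diamond_on 0 2 1 3"
proof (rule pair_pre_digraph.equality)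
  show "parcs diamond = parcs (diamond_on 0 2 1 3)"
    unfolding parcs_diamond parcs_diamond_on by (rule set_eqI, clarsimp) presburger
qed (auto simp: pverts_diamond)

lemma pair_graph_diamond_on:
  assumes "distinct [u, v, x, y]"
  shows "pair_graph (diamond_on u v x y)"
  using assms by unfold_locales (auto simp: symmetric_def intro!: symI)

text \<open>Both sides use \<open>fst\<close> and \<open>snd\<close> as tail and head, which forces
  the arc map of an isomorphism to be induced by its vertex map. What remains is a vertex map that
  is injective on \<open>pverts K\<close>.\<close>

lemma digraph_iso_with_proj_iff:
  assumes "pair_wf_digraph K"
  shows "digraph_iso (with_proj K) (with_proj H) \<longleftrightarrow>
    (\<exists>f. inj_on f (pverts K) \<and> pverts H = f ` pverts K \<and> parcs H = map_prod f f ` parcs K)"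
    (is "?L \<longleftrightarrow> ?R")
proof
  assume ?L
  then obtain h where h: "pre_digraph.digraph_isomorphism (with_proj K) h"
    and H: "with_proj H = app_iso h (with_proj K)"
    by (auto simp: digraph_iso_def)
  have "iso_tail h = fst" "iso_head h = snd"
    using H by (simp_all add: with_proj_def app_iso_def)
  then have arcs: "iso_arcs h e = map_prod (iso_verts h) (iso_verts h) e" if "e \<in> parcs K" for e
    using h that by (cases e) (auto simp: pre_digraph.digraph_isomorphism_def prod_eq_iff)
  have "pverts H = iso_verts h ` pverts K" "parcs H = iso_arcs h ` parcs K"
    using H by (simp_all add: with_proj_def app_iso_def)
  moreover have "iso_arcs h ` parcs K = map_prod (iso_verts h) (iso_verts h) ` parcs K"
    using arcs by (rule image_cong[OF refl])
  moreover have "inj_on (iso_verts h) (pverts K)"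
    using h by (simp add: pre_digraph.digraph_isomorphism_def)
  ultimately show ?R
    by auto
next
  assume ?R
  then obtain f where f: "inj_on f (pverts K)" "pverts H = f ` pverts K"
    "parcs H = map_prod f f ` parcs K"
    by blast
  interpret pair_wf_digraph K by fact
  let ?h = "\<lparr>iso_verts = f, iso_arcs = map_prod f f, iso_head = snd, iso_tail = fst\<rparr>"
  have "inj_on (map_prod f f) (parcs K)"
    using map_prod_inj_on[OF f(1) f(1)]
    by (rule inj_on_subset) (auto dest: in_arcsD1 in_arcsD2)
  then have "pre_digraph.digraph_isomorphism (with_proj K) ?h"
    using f(1) assms by (auto simp: pre_digraph.digraph_isomorphism_def wf_digraph_wp_iff)
  moreover have "with_proj H = app_iso ?h (with_proj K)"
    using f by (simp add: with_proj_def app_iso_def)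
  ultimately show ?L
    by (auto simp: digraph_iso_def)
qed

lemma digraph_iso_diamond_iff:
  assumes "pair_wf_digraph K"
  shows "digraph_iso (with_proj K) (with_proj diamond) \<longleftrightarrow>
    (\<exists>u v x y. distinct [u, v, x, y] \<and> K = diamond_on u v x y)" (is "?L \<longleftrightarrow> ?R")
proof
  assume ?L
  then obtain f where f: "inj_on f (pverts K)" "pverts diamond = f ` pverts K"
    "parcs diamond = map_prod f f ` parcs K"
    unfolding digraph_iso_with_proj_iff[OF assms] by blast
  interpret pair_wf_digraph K by fact
  \<comment> \<open>The inverse isomorphism carries the labels 0, 2 (chord) and 1, 3 (tips) back to
    \<open>K\<close>.\<close>
  define g where "g = the_inv_into (pverts K) f"
  have gf: "g (f w) = w" if "w \<in> pverts K" for w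
    using f(1) that by (simp add: g_def the_inv_into_f_f)
  have "inj_on g (pverts diamond)"
    using f by (simp add: g_def inj_on_the_inv_into)
  then have "distinct [g 0, g 2, g 1, g 3]"
    by (auto simp: pverts_diamond inj_on_def)
  moreover have "pverts K = g ` pverts diamond"
    unfolding f(2) image_image using gf by auto
  then have "pverts K = {g 0, g 2, g 1, g 3}"
    by (auto simp: diamond_eq_diamond_on)
  moreover have "parcs K = map_prod g g ` parcs diamond"
  proof -
    have "map_prod g g (map_prod f f e) = e" if "e \<in> parcs K" for e
      using that gf by (cases e) (auto dest: in_arcsD1 in_arcsD2)
    then show ?thesis
      unfolding f(3) image_image by simp
  qed
  then have "parcs K = parcs (diamond_on (g 0) (g 2) (g 1) (g 3))"
    unfolding diamond_eq_diamond_on by auto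
  ultimately show ?R
    by (intro exI[of _ "g 0"] exI[of _ "g 2"] exI[of _ "g 1"] exI[of _ "g 3"])
      (auto intro!: pair_pre_digraph.equality)
next
  assume ?R
  then obtain u v x y where uvxy: "distinct [u, v, x, y]" and K: "K = diamond_on u v x y"
    by blast
  \<comment> \<open>The default value 0 is the image of \<open>u\<close>, so the chord goes to 0, 2
    and the tips to 1, 3.\<close>
  let ?f = "(\<lambda>_. 0 :: nat)(v := 2, x := 1, y := 3)"
  have "inj_on ?f (pverts K)" "pverts diamond = ?f ` pverts K"
    "parcs diamond = map_prod ?f ?f ` parcs K"
    using uvxy by (auto simp: K diamond_eq_diamond_on inj_on_def)
  then show ?L
    unfolding digraph_iso_with_proj_iff[OF assms] by blast
qed

text \<open>Every vertex of a diamond is an end of one of its arcs, so an inclusion of arcs already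
  gives the inclusion of vertices that \<open>subgraph\<close> asks for.\<close>

lemma copies_diamond:
  assumes "pair_graph G"
  shows "copies diamond G =
    {diamond_on u v x y |u v x y. distinct [u, v, x, y] \<and> parcs (diamond_on u v x y) \<subseteq> parcs G}"
    (is "_ = ?D")
proof -
  interpret pair_graph G by fact
  have wf: "pair_wf_digraph K" if "pair_graph K" for K :: "'a pair_pre_digraph"
    using that by (simp add: pair_graph_def pair_digraph_def pair_fin_digraph_def)
  show ?thesis
  proof (intro equalityI subsetI)
    fix K assume "K \<in> copies diamond G"
    then show "K \<in> ?D"
      using digraph_iso_diamond_iff[OF wf, of K]
      by (fastforce simp: copies_def subgraph_def simp del: parcs_diamond_on)
  next
    fix K assume "K \<in> ?D"
    then obtain u v x y where D: "distinct [u, v, x, y]" "parcs (diamond_on u v x y) \<subseteq> parcs G"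
      and K: "K = diamond_on u v x y"
      by blast
    have "pair_graph K"
      unfolding K using D(1) by (rule pair_graph_diamond_on)
    moreover have "pverts K \<subseteq> pverts G"
      using D K by (auto dest: in_arcsD1 in_arcsD2)
    ultimately show "K \<in> copies diamond G"
      using D K digraph_iso_diamond_iff[OF wf, of K] assms wf
      by (auto simp: copies_def subgraph_def compatible_def wf_digraph_wp_iff
          simp del: parcs_diamond_on)
  qed
qed

section \<open>Girth and short cycles\<close>

definition triangle_free :: "'a pair_pre_digraph \<Rightarrow> bool" where
  "triangle_free G \<longleftrightarrow>
     (\<forall>u v w. (u, v) \<in> parcs G \<longrightarrow> (v, w) \<in> parcs G \<longrightarrow> (w, u) \<notin> parcs G)"

lemma girth_le:
  assumes "pre_digraph.cycle (with_proj G) p" "3 \<le> length p"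
  shows "girth G \<le> enat (length p)"
  unfolding girth_def using assms by (intro INF_lower) auto

text \<open>A nonempty set of extended naturals contains its infimum. The empty set has infinite
  infimum, which a finite girth excludes.\<close>

lemma girth_attained:
  assumes "girth G = enat m"
  obtains p where "pre_digraph.cycle (with_proj G) p" "3 \<le> length p" "length p = m"
proof -
  let ?S = "(\<lambda>p. enat (length p)) ` {p. pre_digraph.cycle (with_proj G) p \<and> 3 \<le> length p}"
  have Inf: "Inf ?S = enat m"
    using assms by (simp only: girth_def)
  then have "?S \<noteq> {}"
    by (metis Inf_enat_def enat.distinct(1))
  then have "Inf ?S \<in> ?S"
    unfolding Inf_enat_def by (metis (no_types, lifting) LeastI_ex ex_in_conv)
  then show thesis
    using that unfolding Inf by auto
qed

text \<open>In a closed walk of three arcs, the absence of loops already makes the vertices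
  distinct.\<close>

lemma cycle_with_proj_3_iff:
  assumes "pair_graph G"
  shows "(\<exists>p. pre_digraph.cycle (with_proj G) p \<and> length p = 3) \<longleftrightarrow> \<not> triangle_free G"
    (is "?L \<longleftrightarrow> ?R")
proof
  interpret pair_graph G by fact
  assume ?L
  then obtain p where "cycle p" "length p = 3"
    by blast
  then show ?R
    by (auto simp: cycle_def awalk_def triangle_free_def length_Suc_conv eval_nat_numeral) blast
next
  interpret pair_graph G by fact
  assume ?R
  then obtain u v w where "(u, v) \<in> parcs G" "(v, w) \<in> parcs G" "(w, u) \<in> parcs G"
    by (auto simp: triangle_free_def)
  then have "cycle [(u, v), (v, w), (w, u)]"
    by (auto simp: cycle_def awalk_def dest: in_arcsD1 no_loops')
  then show ?L
    by (intro exI[of _ "[(u, v), (v, w), (w, u)]"]) simp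
qed

text \<open>Here distinctness has to be stated: a closed walk of four arcs may run back and forth
  along one edge.\<close>

lemma cycle_with_proj_4_iff:
  assumes "pair_graph G"
  shows "(\<exists>p. pre_digraph.cycle (with_proj G) p \<and> length p = 4) \<longleftrightarrow>
    (\<exists>a b c d. distinct [a, b, c, d] \<and> {(a, b), (b, c), (c, d), (d, a)} \<subseteq> parcs G)"
    (is "?L \<longleftrightarrow> ?R")
proof
  interpret pair_graph G by fact
  assume ?L
  then obtain p where "cycle p" "length p = 4"
    by blast
  then show ?R
    by (auto simp: cycle_def awalk_def length_Suc_conv eval_nat_numeral) blast
next
  interpret pair_graph G by fact
  assume ?R
  then obtain a b c d where "distinct [a, b, c, d]" "{(a, b), (b, c), (c, d), (d, a)} \<subseteq> parcs G"
    by blast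
  then have "cycle [(a, b), (b, c), (c, d), (d, a)]"
    by (auto simp: cycle_def awalk_def dest: in_arcsD1)
  then show ?L
    by (intro exI[of _ "[(a, b), (b, c), (c, d), (d, a)]"]) simp
qed

text \<open>Only lengths from 3 on count, so girth 4 means that length 3 does not occur and length 4
  does.\<close>

lemma girth_eq_4_iff:
  assumes "pair_graph G"
  shows "girth G = 4 \<longleftrightarrow> triangle_free G \<and>
    (\<exists>a b c d. distinct [a, b, c, d] \<and> {(a, b), (b, c), (c, d), (d, a)} \<subseteq> parcs G)"
proof -
  have four: "(4 :: enat) = enat 4"
    by (simp add: numeral_eq_enat)
  have "girth G = 4 \<longleftrightarrow>
    \<not> (\<exists>p. pre_digraph.cycle (with_proj G) p \<and> length p = 3) \<and>
    (\<exists>p. pre_digraph.cycle (with_proj G) p \<and> length p = 4)" (is "?L \<longleftrightarrow> ?R")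
  proof
    assume ?L
    then show ?R
      unfolding four using girth_le[of G] girth_attained[of G 4] by fastforce
  next
    assume R: ?R
    have "4 \<le> girth G"
      unfolding girth_def four using R by (intro INF_greatest) (fastforce simp: not_le le_Suc_eq)
    moreover have "girth G \<le> 4"
      unfolding four using R girth_le[of G] by fastforce
    ultimately show ?L
      by simp
  qed
  then show ?thesis
    using cycle_with_proj_3_iff[OF assms] cycle_with_proj_4_iff[OF assms] by simp
qed

section \<open>Saturation and common neighbours\<close>

text \<open>Both triangles of a new diamond contain the added edge, which is therefore its chord.\<close>

lemma copies_diamond_add_edge:
  assumes "pair_graph G" "triangle_free G" "u \<in> pverts G" "v \<in> pverts G" "u \<noteq> v"
    "(u, v) \<notin> parcs G"
  shows "copies diamond (add_edge G u v) =
    {diamond_on u v x y |x y. x \<in> common_neighbors G u v \<and> y \<in> common_neighbors G u v \<and> x \<noteq> y}"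
    (is "_ = ?D")
proof (intro equalityI subsetI)
  interpret pair_graph G by fact
  let ?E = "parcs (add_edge G u v)"
  \<comment> \<open>As \<open>G\<close> has no triangle, at least one side of a triangle in the
    extended graph is the new edge.\<close>
  have chord: "{a, b} = {u, v} \<or> {b, w} = {u, v} \<or> {a, w} = {u, v}"
    if "(a, b) \<in> ?E" "(b, w) \<in> ?E" "(w, a) \<in> ?E" for a b w
    using that assms(2) by (auto simp: add_edge_def triangle_free_def)
  {
    fix K assume "K \<in> copies diamond (add_edge G u v)"
    then obtain a b x y where K: "K = diamond_on a b x y" and d: "distinct [a, b, x, y]"
      and E: "parcs (diamond_on a b x y) \<subseteq> ?E"
      by (auto simp: copies_diamond[OF pair_graph_add_edge[OF assms(1,3,4,5)]]
          simp del: parcs_diamond_on)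
    have "{a, b} = {u, v} \<or> {b, x} = {u, v} \<or> {a, x} = {u, v}"
      "{a, b} = {u, v} \<or> {b, y} = {u, v} \<or> {a, y} = {u, v}"
      using E chord[of a b x] chord[of a b y] by simp_all
    then have ab: "a = u \<and> b = v \<or> a = v \<and> b = u"
      using d by (auto simp: doubleton_eq_iff)
    then have "x \<in> common_neighbors G u v" "y \<in> common_neighbors G u v"
      using E d by (auto simp: add_edge_def common_neighbors_def dest: in_arcsD2)
    moreover have "K = diamond_on u v x y"
      using ab K diamond_on_swap_chord by metis
    ultimately show "K \<in> ?D"
      using d by auto
  next
    fix K assume "K \<in> ?D"
    then obtain x y where "K = diamond_on u v x y" "x \<in> common_neighbors G u v"
      "y \<in> common_neighbors G u v" "x \<noteq> y"
      by blast
    moreover from this have "distinct [u, v, x, y]" "parcs (diamond_on u v x y) \<subseteq> ?E"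
      using assms(5) by (auto simp: common_neighbors_def add_edge_def
          dest: no_loops' arcs_symmetric)
    ultimately show "K \<in> copies diamond (add_edge G u v)"
      unfolding copies_diamond[OF pair_graph_add_edge[OF assms(1,3,4,5)]] by blast
  }
qed

text \<open>The chord is fixed, so a copy determines its unordered pair of tips and conversely. A
  set has exactly one two-element subset iff it has two elements.\<close>

lemma ex1_copy_diamond_add_edge_iff:
  assumes "pair_graph G" "triangle_free G" "u \<in> pverts G" "v \<in> pverts G" "u \<noteq> v"
    "(u, v) \<notin> parcs G"
  shows "(\<exists>!K. K \<in> copies diamond (add_edge G u v)) \<longleftrightarrow> card (common_neighbors G u v) = 2"
    (is "?L \<longleftrightarrow> card ?N = 2")
proof -
  interpret pair_graph G by fact
  note copies = copies_diamond_add_edge[OF assms]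
  have uv: "u \<notin> ?N" "v \<notin> ?N"
    by (auto simp: common_neighbors_def dest: no_loops')
  have tips: "{x, y} = pverts (diamond_on u v x y) - {u, v}" if "x \<in> ?N" "y \<in> ?N" for x y
    using that uv by auto
  show ?thesis
  proof
    assume ?L
    then obtain x y where xy: "x \<in> ?N" "y \<in> ?N" "x \<noteq> y"
      by (auto simp: copies)
    have "z \<in> {x, y}" if "z \<in> ?N" for z
    proof (rule ccontr)
      assume "z \<notin> {x, y}"
      \<comment> \<open>A third common neighbour \<open>z\<close> would give another copy, with tips
        \<open>x\<close> and \<open>z\<close>; uniqueness identifies the two.\<close>
      then have "diamond_on u v x z = diamond_on u v x y"
        using \<open>?L\<close> xy that unfolding copies by blast
      then have "{x, z} = {x, y}"
        using tips xy that by metis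
      then show False
        using \<open>z \<notin> {x, y}\<close> by auto
    qed
    then have "?N = {x, y}"
      using xy by blast
    then show "card ?N = 2"
      using xy by simp
  next
    assume "card ?N = 2"
    then obtain x y where "?N = {x, y}" "x \<noteq> y"
      by (auto simp: card_2_iff)
    then have "copies diamond (add_edge G u v) = {diamond_on u v x y}"
      \<comment> \<open>The two orderings of the tips give the same subgraph.\<close>
      unfolding copies using diamond_on_swap_tips by (auto 4 3)
    then show ?L
      by simp
  qed
qed

lemma copies_diamond_triangle_free:
  assumes "pair_graph G" "triangle_free G"
  shows "copies diamond G = {}"
proof -
  have "\<not> parcs (diamond_on u v x y) \<subseteq> parcs G" for u v x y
  proof
    assume "parcs (diamond_on u v x y) \<subseteq> parcs G"
    then have "(u, v) \<in> parcs G" "(v, x) \<in> parcs G" "(x, u) \<in> parcs G"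
      by auto
    then show False
      using assms(2) unfolding triangle_free_def by blast
  qed
  then show ?thesis
    unfolding copies_diamond[OF assms(1)] by blast
qed

lemma uniquely_saturated_diamond_iff:
  assumes "pair_graph G" "triangle_free G"
  shows "uniquely_saturated diamond G \<longleftrightarrow>
    (\<forall>u \<in> pverts G. \<forall>v \<in> pverts G. u \<noteq> v \<and> (u, v) \<notin> parcs G \<longrightarrow>
      card (common_neighbors G u v) = 2)"
  unfolding uniquely_saturated_def copies_diamond_triangle_free[OF assms]
  using ex1_copy_diamond_add_edge_iff[OF assms] by blast

lemma triangle_free_iff_card_common_neighbors:
  assumes "pair_graph G"
  shows "triangle_free G \<longleftrightarrow>
    (\<forall>u \<in> pverts G. \<forall>v \<in> pverts G. (u, v) \<in> parcs G \<longrightarrow> card (common_neighbors G u v) = 0)"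
proof -
  interpret pair_graph G by fact
  \<comment> \<open>Infinite sets also have \<open>card\<close> 0, so finiteness is what lets
    \<open>card\<close> 0 mean emptiness.\<close>
  have "finite (common_neighbors G u v)" for u v
    by (simp add: common_neighbors_def)
  then show ?thesis
    unfolding triangle_free_def common_neighbors_def
    by (auto dest: in_arcsD1 in_arcsD2 arcs_symmetric)
qed

section \<open>Regularity\<close>

text \<open>
  A neighbour \<open>w \<noteq> v\<close> of \<open>u\<close> has exactly one common neighbour with \<open>v\<close> besides \<open>u\<close>. Two such \<open>w\<close>
  cannot share it, since together with \<open>v\<close> they would be three common neighbours of it and \<open>u\<close>.
\<close>

lemma card_neighbors_le_of_adjacent:
  assumes "pair_graph G" "triangle_free G"
    and two: "\<And>u v. u \<in> pverts G \<Longrightarrow> v \<in> pverts G \<Longrightarrow> u \<noteq> v \<Longrightarrow> (u, v) \<notin> parcs G \<Longrightarrow>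
      card (common_neighbors G u v) = 2"
    and uv: "(u, v) \<in> parcs G"
  shows "card {w. (u, w) \<in> parcs G} \<le> card {w. (v, w) \<in> parcs G}"
proof -
  interpret pair_graph G by fact
  let ?N = "\<lambda>u. {w. (u, w) \<in> parcs G}"
  have fin: "finite (?N w)" for w
    by (rule finite_subset[OF _ finite_verts]) (auto dest: in_arcsD2)
  have tf: "(c, a) \<notin> parcs G" if "(a, b) \<in> parcs G" "(b, c) \<in> parcs G" for a b c
    using that assms(2) unfolding triangle_free_def by blast
  have "\<exists>x. x \<noteq> u \<and> (v, x) \<in> parcs G \<and> (w, x) \<in> parcs G" if "w \<in> ?N u - {v}" for w
  proof -
    have "(v, w) \<notin> parcs G"
      using that uv tf arcs_symmetric by blast
    then have "card (common_neighbors G v w) = 2"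
      using that uv by (intro two) (auto dest: in_arcsD2)
    \<comment> \<open>\<open>u\<close> is one of the two common neighbours of \<open>v\<close> and
      \<open>w\<close>; the other one serves as \<open>f w\<close>.\<close>
    then have "\<not> common_neighbors G v w \<subseteq> {u}"
      using card_mono[of "{u}" "common_neighbors G v w"] by auto
    then show ?thesis
      by (auto simp: common_neighbors_def)
  qed
  then obtain f where f: "\<And>w. w \<in> ?N u - {v} \<Longrightarrow>
      f w \<noteq> u \<and> (v, f w) \<in> parcs G \<and> (w, f w) \<in> parcs G"
    by metis
  have "inj_on f (?N u - {v})"
  proof (rule inj_onI, rule ccontr)
    fix w w' assume w: "w \<in> ?N u - {v}" "w' \<in> ?N u - {v}" "f w = f w'" "w \<noteq> w'"
    \<comment> \<open>Such an arc would close a triangle with \<open>v\<close>.\<close>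
    have "(u, f w) \<notin> parcs G"
      using f[OF w(1)] uv tf arcs_symmetric by blast
    then have "card (common_neighbors G u (f w)) = 2"
      using f[OF w(1)] uv by (intro two) (auto dest: in_arcsD1 in_arcsD2)
    moreover have "{v, w, w'} \<subseteq> common_neighbors G u (f w)"
      using f[OF w(1)] f[OF w(2)] w uv
      by (auto simp: common_neighbors_def dest: in_arcsD2 arcs_symmetric)
    moreover have "finite (common_neighbors G u (f w))"
      by (simp add: common_neighbors_def)
    moreover have "card {v, w, w'} = 3"
      using w by auto
    ultimately show False
      using card_mono[of "common_neighbors G u (f w)" "{v, w, w'}"] by linarith
  qed
  moreover have "f ` (?N u - {v}) \<subseteq> ?N v - {u}"
    using f by auto
  ultimately have "card (?N u - {v}) \<le> card (?N v - {u})"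
    using fin by (intro card_inj_on_le) auto
  \<comment> \<open>Positivity allows the truncated subtraction of 1 on both sides to be
    cancelled.\<close>
  moreover have "card (?N u) > 0" "card (?N v) > 0"
    using uv fin arcs_symmetric by (auto simp: card_gt_0_iff)
  ultimately show ?thesis
    using uv arcs_symmetric[OF uv] fin by (simp add: card_Diff_singleton)
qed

text \<open>For adjacent vertices the degree inequality holds in both directions. Non-adjacent
  distinct vertices have a common neighbour, through which equality passes.\<close>

lemma out_degree_eq:
  assumes "pair_graph G" "triangle_free G"
    and two: "\<And>u v. u \<in> pverts G \<Longrightarrow> v \<in> pverts G \<Longrightarrow> u \<noteq> v \<Longrightarrow> (u, v) \<notin> parcs G \<Longrightarrow>
      card (common_neighbors G u v) = 2"
    and "u \<in> pverts G" "v \<in> pverts G"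
  shows "out_degree (with_proj G) u = out_degree (with_proj G) v"
proof -
  interpret pair_graph G by fact
  have out: "out_degree (with_proj G) a = card {w. (a, w) \<in> parcs G}" for a
  proof -
    have "out_arcs (with_proj G) a = Pair a ` {w. (a, w) \<in> parcs G}"
      by (auto simp: out_arcs_def)
    then show ?thesis
      by (simp add: out_degree_def card_image inj_on_def)
  qed
  have adj: "out_degree (with_proj G) a = out_degree (with_proj G) b" if "(a, b) \<in> parcs G" for a b
    using card_neighbors_le_of_adjacent[OF assms(1,2) two] that arcs_symmetric[OF that]
    by (simp add: out antisym)
  show ?thesis
  proof (cases "u = v \<or> (u, v) \<in> parcs G")
    case True
    then show ?thesis
      using adj by auto
  next
    case False
    then have "common_neighbors G u v \<noteq> {}"
      using two[OF assms(4,5)] by auto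
    then obtain w where "(u, w) \<in> parcs G" "(v, w) \<in> parcs G"
      by (auto simp: common_neighbors_def)
    then show ?thesis
      using adj by metis
  qed
qed

section \<open>The 4-cycle and the equivalence\<close>

lemma ex_4_cycle_if_not_complete:
  assumes "pair_graph G" "\<not> complete_digraph (card (pverts G)) (with_proj G)"
    and two: "\<And>u v. u \<in> pverts G \<Longrightarrow> v \<in> pverts G \<Longrightarrow> u \<noteq> v \<Longrightarrow> (u, v) \<notin> parcs G \<Longrightarrow>
      card (common_neighbors G u v) = 2"
  shows "\<exists>a b c d. distinct [a, b, c, d] \<and> {(a, b), (b, c), (c, d), (d, a)} \<subseteq> parcs G"
proof -
  interpret pair_graph G by fact
  \<comment> \<open>The order in \<open>complete_digraph\<close> is the actual number of vertices,
    so completeness can fail only by a missing arc.\<close>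
  obtain u v where uv: "u \<in> pverts G" "v \<in> pverts G" "u \<noteq> v" "(u, v) \<notin> parcs G"
    using assms(2) by (auto simp: complete_digraph_pair_def dest: in_arcsD1 in_arcsD2 no_loops')
  then obtain x y where "common_neighbors G u v = {x, y}" "x \<noteq> y"
    using two[OF uv] by (auto simp: card_2_iff)
  then have xy: "x \<noteq> y" "(u, x) \<in> parcs G" "(v, x) \<in> parcs G" "(u, y) \<in> parcs G"
    "(v, y) \<in> parcs G"
    by (auto simp: common_neighbors_def)
  \<comment> \<open>\<open>u\<close> and \<open>v\<close> are opposite corners of the cycle, their
    two common neighbours the other corners.\<close>
  then have "distinct [u, x, v, y]" "{(u, x), (x, v), (v, y), (y, u)} \<subseteq> parcs G"
    using uv by (auto dest: no_loops' intro: arcs_symmetric)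
  then show ?thesis
    by blast
qed

theorem theorem3p1:
  fixes G :: "'a pair_pre_digraph" and n :: nat
  assumes "pair_graph G" and "card (pverts G) = n"
  shows "(uniquely_saturated diamond G \<and> girth G = 4) \<longleftrightarrow> (\<exists>k. strongly_regular G n k 0 2)"
proof
  interpret pair_graph G by fact
  assume L: "uniquely_saturated diamond G \<and> girth G = 4"
  then have tf: "triangle_free G"
    using girth_eq_4_iff[OF assms(1)] by blast
  obtain a b c d where abcd: "distinct [a, b, c, d]"
    "{(a, b), (b, c), (c, d), (d, a)} \<subseteq> parcs G"
    using L girth_eq_4_iff[OF assms(1)] by blast
  have two: "card (common_neighbors G u v) = 2"
    if "u \<in> pverts G" "v \<in> pverts G" "u \<noteq> v" "(u, v) \<notin> parcs G" for u v
    using L uniquely_saturated_diamond_iff[OF assms(1) tf] that by blast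
  \<comment> \<open>A diagonal of the 4-cycle would close a triangle, so opposite corners witness
    that \<open>G\<close> is not complete.\<close>
  have "(c, a) \<notin> parcs G"
    using abcd tf by (auto simp: triangle_free_def)
  moreover have "a \<in> pverts G" "c \<in> pverts G" "a \<noteq> c"
    using abcd by (auto dest: in_arcsD1)
  ultimately have "\<not> complete_digraph n (with_proj G)"
    by (auto simp: complete_digraph_pair_def)
  \<comment> \<open>All degrees agree, so the degree of the corner \<open>a\<close> serves as
    \<open>k\<close>.\<close>
  then have "strongly_regular G n (out_degree (with_proj G) a) 0 2"
    using assms abcd tf two triangle_free_iff_card_common_neighbors[OF assms(1)]
      out_degree_eq[OF assms(1) tf two _ \<open>a \<in> pverts G\<close>]
    unfolding strongly_regular_def by blast
  then show "\<exists>k. strongly_regular G n k 0 2" ..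
next
  assume "\<exists>k. strongly_regular G n k 0 2"
  then obtain k where R: "strongly_regular G n k 0 2" ..
  then have tf: "triangle_free G"
    by (simp add: triangle_free_iff_card_common_neighbors[OF assms(1)] strongly_regular_def)
  moreover have "uniquely_saturated diamond G"
    using R by (simp add: uniquely_saturated_diamond_iff[OF assms(1) tf] strongly_regular_def)
  moreover have "\<exists>a b c d. distinct [a, b, c, d] \<and> {(a, b), (b, c), (c, d), (d, a)} \<subseteq> parcs G"
    using R assms by (intro ex_4_cycle_if_not_complete) (auto simp: strongly_regular_def)
  ultimately show "uniquely_saturated diamond G \<and> girth G = 4"
    using girth_eq_4_iff[OF assms(1)] by blast
qed

end
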